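(* For real $p\neq0$ and real $\alpha,\beta$, consider the two-sided inequality $$\alpha\cos^pt+(1-\alpha)<e^{p(t\cot t-1)}<\beta\cos^pt+(1-\beta)\qquad\text{for all }t\in(0,\pi/2).\tag{$*$}$$ (i) If $p\ge 6/5$, then $( * )$ holds if and only if $\alpha\ge 1-e^{-p}$ and $\beta\le 2/3$. (ii) If $0<p\le1$, then $( * )$ holds if and only if $\alpha\ge 2/3$ and $\beta\le 1-e^{-p}$. (iii) If $p<0$, then $( * )$ holds if and only if $\alpha\le0$ and $\beta\ge 2/3$. (iv) For real $p,q$, the double inequality $$M_p\left(\cos t,1;\tfrac23\right)<e^{t\cot t-1}<M_q\left(\cos t,1;\tfrac23\right)$$ holds for all $t\in(0,\pi/2)$ if and only if $p\le\ln3$ and $q\ge6/5$.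
   Context: For $x,y>0$, $w\in(0,1)$ and real $r$, the weighted power mean of order $r$ is $M_r(x,y;w)=\left(wx^r+(1-w)y^r\right)^{1/r}$ if $r\ne0$, and $M_0(x,y;w)=x^wy^{1-w}$. *)

theory Defs
  imports Complex_Main
begin

text \<open>The weighted power mean of order \<open>r\<close> is meant for \<open>x, y > 0\<close> and \<open>0 < w < 1\<close>.\<close>

definition power_mean :: "real \<Rightarrow> real \<Rightarrow> real \<Rightarrow> real \<Rightarrow> real" where
  "power_mean r x y w =
     (if r = 0 then x powr w * y powr (1 - w)
      else (w * x powr r + (1 - w) * y powr r) powr (1 / r))"

definition two_sided_bound :: "real \<Rightarrow> real \<Rightarrow> real \<Rightarrow> bool" where
  "two_sided_bound p \<alpha> \<beta> \<longleftrightarrow>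
     (\<forall>t\<in>{0<..<pi / 2}.
        \<alpha> * cos t powr p + (1 - \<alpha>) < exp (p * (t * cot t - 1)) \<and>
        exp (p * (t * cot t - 1)) < \<beta> * cos t powr p + (1 - \<beta>))"

end

theory Submission
  imports Defs "HOL-Real_Asymp.Real_Asymp"
begin

text \<open>Write \<open>H(t) = t cot t - 1\<close>, \<open>f(t) = (1 - e\<^bsup>pH(t)\<^esup>) / p\<close> and \<open>g(t) = (1 - cos\<^sup>p t) / p\<close>. All four parts
  compare \<open>f\<close> with a multiple of \<open>g\<close>, and both functions vanish at \<open>0\<close>. The ratio \<open>\<rho> = f' / g'\<close> tends
  to \<open>2/3\<close> at \<open>0\<close>, and \<open>\<rho>'\<close> has the sign of \<open>p - 1 - R(t)\<close>, where \<open>R\<close> does not depend on \<open>p\<close> and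
  decreases strictly from \<open>1/5\<close> while remaining positive. Hence \<open>\<rho>\<close> increases for \<open>p \<ge> 6/5\<close>, decreases
  for \<open>p \<le> 1\<close>, and in between can only change from decreasing to increasing. This fixes the sign
  pattern of \<open>(f - \<lambda> g)' = g' (\<rho> - \<lambda>)\<close>, and with it the sign of \<open>f - \<lambda> g\<close>, once the limits at
  \<open>0\<close> and \<open>\<pi>/2\<close> are known. The same limits show that the constants are sharp.\<close>

section \<open>Elementary inequalities on (0, pi) by repeated differentiation\<close>

lemma pos_of_deriv_pos:
  fixes f f' :: "real \<Rightarrow> real"
  assumes "\<And>x. (f has_real_derivative f' x) (at x)" "f 0 = 0"
    and "\<And>y. 0 < y \<Longrightarrow> y < b \<Longrightarrow> 0 < f' y" "0 < x" "x < b"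
  shows "0 < f x"
proof -
  obtain z where "0 < z" "z < x" "f x - f 0 = (x - 0) * f' z"
    using MVT2[of 0 x f f'] assms(1,4) by blast
  then show ?thesis using assms by auto
qed

text \<open>Start of a chain in which each expression vanishes at 0 and has the previous one as its
  derivative: this one, \<open>two_cos_plus_x_sin_less\<close>, \<open>cusa_inequality\<close>,
  \<open>critical_numerator_double_pos\<close>.\<close>

lemma x_cos_less_sin:
  fixes x :: real
  assumes "0 < x" "x < pi"
  shows "0 < sin x - x * cos x"
proof (rule pos_of_deriv_pos[where f = "\<lambda>x. sin x - x * cos x" and b = pi])
  show "((\<lambda>x. sin x - x * cos x) has_real_derivative x * sin x) (at x)" for x :: real
    by (auto intro!: derivative_eq_intros)
qed (use assms in \<open>auto intro!: mult_pos_pos sin_gt_zero\<close>)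

lemma two_cos_plus_x_sin_less:
  fixes x :: real
  assumes "0 < x" "x < pi"
  shows "0 < 2 - 2 * cos x - x * sin x"
proof (rule pos_of_deriv_pos[where f = "\<lambda>x. 2 - 2 * cos x - x * sin x" and b = pi])
  show "((\<lambda>x. 2 - 2 * cos x - x * sin x) has_real_derivative sin x - x * cos x) (at x)" for x :: real
    by (auto intro!: derivative_eq_intros)
qed (use assms x_cos_less_sin in auto)

lemma cusa_inequality:
  fixes x :: real
  assumes "0 < x" "x < pi"
  shows "0 < 2 * x + x * cos x - 3 * sin x"
proof (rule pos_of_deriv_pos[where f = "\<lambda>x. 2 * x + x * cos x - 3 * sin x" and b = pi])
  show "((\<lambda>x. 2 * x + x * cos x - 3 * sin x) has_real_derivative 2 - 2 * cos x - x * sin x) (at x)"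
    for x :: real
    by (auto intro!: derivative_eq_intros)
qed (use assms two_cos_plus_x_sin_less in auto)

text \<open>The next four inequalities are used at \<open>x = 2 t\<close>, where \<open>sin\<^sup>2 t\<close> and \<open>sin t cos t\<close>
  become linear in \<open>sin x\<close> and \<open>cos x\<close>, so that repeated differentiation terminates.\<close>

lemma critical_numerator_double_pos:
  fixes x :: real
  assumes "0 < x" "x < pi"
  shows "0 < x\<^sup>2 + x * sin x - 4 + 4 * cos x"
proof (rule pos_of_deriv_pos[where f = "\<lambda>x. x\<^sup>2 + x * sin x - 4 + 4 * cos x" and b = pi])
  show "((\<lambda>x. x\<^sup>2 + x * sin x - 4 + 4 * cos x) has_real_derivative 2 * x + x * cos x - 3 * sin x) (at x)"
    for x :: real
    by (auto intro!: derivative_eq_intros)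
qed (use assms cusa_inequality in auto)

lemma numerator_growth_double:
  fixes x :: real
  assumes x: "0 < x" "x < pi"
  shows "0 < 4 * x\<^sup>2 + 9 * x * sin x - x\<^sup>2 * cos x - 24 * (1 - cos x)"
proof -
  \<comment> \<open>The facts \<open>3\<close>, \<open>2\<close>, \<open>1\<close> treat the third,
    second and first derivative of the expression, all of which vanish at 0. The next two proofs use
    the same numbering.\<close>
  have 3: "0 < 3 * sin x - 3 * x * cos x - x\<^sup>2 * sin x" if "0 < x" "x < pi" for x :: real
  proof (rule pos_of_deriv_pos[where f = "\<lambda>x. 3 * sin x - 3 * x * cos x - x\<^sup>2 * sin x" and b = pi])
    show "((\<lambda>x. 3 * sin x - 3 * x * cos x - x\<^sup>2 * sin x) has_real_derivative
        x * (sin x - x * cos x)) (at x)" for x :: real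
      by (auto intro!: derivative_eq_intros simp: algebra_simps power2_eq_square)
  qed (use that x_cos_less_sin in auto)
  have 2: "0 < 8 + x\<^sup>2 * cos x - 8 * cos x - 5 * x * sin x" if "0 < x" "x < pi" for x :: real
  proof (rule pos_of_deriv_pos[where f = "\<lambda>x. 8 + x\<^sup>2 * cos x - 8 * cos x - 5 * x * sin x" and b = pi])
    show "((\<lambda>x. 8 + x\<^sup>2 * cos x - 8 * cos x - 5 * x * sin x) has_real_derivative
        3 * sin x - 3 * x * cos x - x\<^sup>2 * sin x) (at x)" for x :: real
      by (auto intro!: derivative_eq_intros simp: algebra_simps)
  qed (use that 3 in auto)
  have 1: "0 < 8 * x + 7 * x * cos x + x\<^sup>2 * sin x - 15 * sin x" if "0 < x" "x < pi" for x :: real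
  proof (rule pos_of_deriv_pos[where f = "\<lambda>x. 8 * x + 7 * x * cos x + x\<^sup>2 * sin x - 15 * sin x" and b = pi])
    show "((\<lambda>x. 8 * x + 7 * x * cos x + x\<^sup>2 * sin x - 15 * sin x) has_real_derivative
        8 + x\<^sup>2 * cos x - 8 * cos x - 5 * x * sin x) (at x)" for x :: real
      by (auto intro!: derivative_eq_intros simp: algebra_simps)
  qed (use that 2 in auto)
  show ?thesis
  proof (rule pos_of_deriv_pos[where f = "\<lambda>x. 4 * x\<^sup>2 + 9 * x * sin x - x\<^sup>2 * cos x - 24 * (1 - cos x)" and b = pi])
    show "((\<lambda>x. 4 * x\<^sup>2 + 9 * x * sin x - x\<^sup>2 * cos x - 24 * (1 - cos x)) has_real_derivative
        8 * x + 7 * x * cos x + x\<^sup>2 * sin x - 15 * sin x) (at x)" for x :: real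
      by (auto intro!: derivative_eq_intros simp: algebra_simps)
  qed (use x 1 in auto)
qed

lemma t_minus_sin_cos_growth_double:
  fixes x :: real
  assumes x: "0 < x" "x < pi"
  shows "0 < x ^ 3 - 16 * x - 8 * x * cos x + 24 * sin x - x\<^sup>2 * sin x"
proof -
  have 3: "0 < 6 - 6 * cos x - 2 * x * sin x + x\<^sup>2 * cos x" if "0 < x" "x < pi" for x :: real
  proof -
    let ?f = "\<lambda>x::real. 6 - 6 * cos x - 2 * x * sin x + x\<^sup>2 * cos x"
    have d: "(?f has_real_derivative (4 - x\<^sup>2) * sin x) (at x)" for x :: real
      by (auto intro!: derivative_eq_intros simp: algebra_simps)
    \<comment> \<open>The derivative changes sign at 2. Up to 2 the function increases from 0;
      afterwards it decreases, so there it is at least its value \<open>12 - pi^2\<close> at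
      \<open>pi\<close>.\<close>
    have sgn: "0 < 4 - y\<^sup>2 \<longleftrightarrow> y < 2" if "0 < y" for y :: real
      using that power_strict_mono[of y 2 2] power_mono[of 2 y 2] by (force simp: not_less)
    show ?thesis
    proof (cases "x < 2")
      case True
      show ?thesis
        by (rule pos_of_deriv_pos[where f = ?f and b = 2, OF d])
           (use that True sgn pi_ge_two in \<open>auto intro!: mult_pos_pos sin_gt_zero\<close>)
    next
      case False
      obtain z where z: "x < z" "z < pi" "?f pi - ?f x = (pi - x) * ((4 - z\<^sup>2) * sin z)"
        using MVT2[of x pi ?f "\<lambda>z. (4 - z\<^sup>2) * sin z"] d \<open>x < pi\<close> by blast
      have "(4 - z\<^sup>2) * sin z \<le> 0"
        using z sgn[of z] False that by (intro mult_nonpos_nonneg sin_ge_zero) auto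
      then have "?f pi \<le> ?f x" using z by (smt (verit) mult_nonneg_nonpos)
      moreover have "pi\<^sup>2 < 12"
      proof -
        \<comment> \<open>This is \<open>x cos x < sin x\<close> at \<open>pi / 6\<close>; squaring
          it gives \<open>pi^2 < 12\<close>.\<close>
        have "pi * sqrt 3 < 6"
          using x_cos_less_sin[of "pi / 6"] by (simp add: cos_30 sin_30)
        then have "(pi * sqrt 3)\<^sup>2 < 6\<^sup>2" by (intro power_strict_mono) auto
        then show ?thesis by (simp add: power_mult_distrib)
      qed
      ultimately show ?thesis by simp
    qed
  qed
  have 2: "0 < 6 * x + 4 * x * cos x - 10 * sin x + x\<^sup>2 * sin x" if "0 < x" "x < pi" for x :: real
  proof (rule pos_of_deriv_pos[where f = "\<lambda>x. 6 * x + 4 * x * cos x - 10 * sin x + x\<^sup>2 * sin x" and b = pi])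
    show "((\<lambda>x. 6 * x + 4 * x * cos x - 10 * sin x + x\<^sup>2 * sin x) has_real_derivative
        6 - 6 * cos x - 2 * x * sin x + x\<^sup>2 * cos x) (at x)" for x :: real
      by (auto intro!: derivative_eq_intros simp: algebra_simps)
  qed (use that 3 in auto)
  have 1: "0 < 3 * x\<^sup>2 - 16 + 16 * cos x + 6 * x * sin x - x\<^sup>2 * cos x" if "0 < x" "x < pi" for x :: real
  proof (rule pos_of_deriv_pos[where f = "\<lambda>x. 3 * x\<^sup>2 - 16 + 16 * cos x + 6 * x * sin x - x\<^sup>2 * cos x" and b = pi])
    show "((\<lambda>x. 3 * x\<^sup>2 - 16 + 16 * cos x + 6 * x * sin x - x\<^sup>2 * cos x) has_real_derivative
        6 * x + 4 * x * cos x - 10 * sin x + x\<^sup>2 * sin x) (at x)" for x :: real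
      by (auto intro!: derivative_eq_intros simp: algebra_simps)
  qed (use that 2 in auto)
  show ?thesis
  proof (rule pos_of_deriv_pos[where f = "\<lambda>x. x ^ 3 - 16 * x - 8 * x * cos x + 24 * sin x - x\<^sup>2 * sin x" and b = pi])
    show "((\<lambda>x. x ^ 3 - 16 * x - 8 * x * cos x + 24 * sin x - x\<^sup>2 * sin x) has_real_derivative
        3 * x\<^sup>2 - 16 + 16 * cos x + 6 * x * sin x - x\<^sup>2 * cos x) (at x)" for x :: real
      by (auto intro!: derivative_eq_intros simp: algebra_simps)
  qed (use x 1 in auto)
qed

lemma tan_minus_t_growth_double:
  fixes x :: real
  assumes x: "0 < x" "x < pi"
  shows "0 < 32 * x + 16 * x * cos x - 48 * sin x - 2 * x\<^sup>2 * sin x + x ^ 3 + x ^ 3 * cos x"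
proof -
  have 3: "0 < 6 * (1 - cos x) + x * sin x * (10 + x\<^sup>2) - 7 * x\<^sup>2 * cos x" if "0 < x" "x < pi" for x :: real
  proof -
    \<comment> \<open>No further differentiation is needed: \<open>x cos x < sin x\<close> gives
      \<open>a \<le> b\<close>, so \<open>10 b - 7 a\<close> is at least \<open>3 b > 0\<close>, and
      the other two terms are nonnegative.\<close>
    define a b d where "a = x * (x * cos x)" and "b = x * sin x" and "d = x * sin x * x\<^sup>2"
    have "a \<le> b"
      unfolding a_def b_def using x_cos_less_sin[OF that] that by (intro mult_left_mono) auto
    moreover have "0 \<le> d" "0 < b"
      unfolding b_def d_def using that by (simp_all add: sin_gt_zero less_imp_le)
    moreover have "6 * (1 - cos x) + x * sin x * (10 + x\<^sup>2) - 7 * x\<^sup>2 * cos x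
        = 6 * (1 - cos x) + 10 * b + d - 7 * a" unfolding a_def b_def d_def by algebra
    moreover have "0 \<le> 6 * (1 - cos x)" by simp
    moreover have "0 < 6 * (1 - cos x) + 10 * b + d - 7 * a"
      using calculation(1-3,5) by argo
    ultimately show ?thesis by simp
  qed
  have 2: "0 < 12 * sin x - 18 * x * cos x + 6 * x - 4 * x\<^sup>2 * sin x - x ^ 3 * cos x" if "0 < x" "x < pi" for x :: real
  proof (rule pos_of_deriv_pos[where f = "\<lambda>x. 12 * sin x - 18 * x * cos x + 6 * x - 4 * x\<^sup>2 * sin x - x ^ 3 * cos x" and b = pi])
    show "((\<lambda>x. 12 * sin x - 18 * x * cos x + 6 * x - 4 * x\<^sup>2 * sin x - x ^ 3 * cos x) has_real_derivative
        6 * (1 - cos x) + x * sin x * (10 + x\<^sup>2) - 7 * x\<^sup>2 * cos x) (at x)" for x :: real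
      by (auto intro!: derivative_eq_intros simp: algebra_simps power2_eq_square power3_eq_cube)
  qed (use that 3 in auto)
  have 1: "0 < 32 - 32 * cos x - 20 * x * sin x + 3 * x\<^sup>2 + x\<^sup>2 * cos x - x ^ 3 * sin x" if "0 < x" "x < pi" for x :: real
  proof (rule pos_of_deriv_pos[where f = "\<lambda>x. 32 - 32 * cos x - 20 * x * sin x + 3 * x\<^sup>2 + x\<^sup>2 * cos x - x ^ 3 * sin x" and b = pi])
    show "((\<lambda>x. 32 - 32 * cos x - 20 * x * sin x + 3 * x\<^sup>2 + x\<^sup>2 * cos x - x ^ 3 * sin x) has_real_derivative
        12 * sin x - 18 * x * cos x + 6 * x - 4 * x\<^sup>2 * sin x - x ^ 3 * cos x) (at x)" for x :: real
      by (auto intro!: derivative_eq_intros simp: algebra_simps power2_eq_square power3_eq_cube)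
  qed (use that 2 in auto)
  show ?thesis
  proof (rule pos_of_deriv_pos[where f = "\<lambda>x. 32 * x + 16 * x * cos x - 48 * sin x - 2 * x\<^sup>2 * sin x + x ^ 3 + x ^ 3 * cos x" and b = pi])
    show "((\<lambda>x. 32 * x + 16 * x * cos x - 48 * sin x - 2 * x\<^sup>2 * sin x + x ^ 3 + x ^ 3 * cos x) has_real_derivative
        32 - 32 * cos x - 20 * x * sin x + 3 * x\<^sup>2 + x\<^sup>2 * cos x - x ^ 3 * sin x) (at x)" for x :: real
      by (auto intro!: derivative_eq_intros simp: algebra_simps power2_eq_square power3_eq_cube)
  qed (use x 1 in auto)
qed

section \<open>The critical order and the ratio of derivatives\<close>

text \<open>The function \<open>R\<close> of the overview: the value of \<open>p - 1\<close> at
  which the derivative of \<open>slope_ratio p\<close> vanishes at \<open>t\<close>.\<close>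

definition critical_order :: "real \<Rightarrow> real" where
  "critical_order t = (t\<^sup>2 + t * sin t * cos t - 2 * (sin t)\<^sup>2) / ((tan t - t) * (t - sin t * cos t))"

text \<open>The numerator behaves like \<open>2 t^6 / 45\<close> and the denominator like
  \<open>2 t^6 / 9\<close>. This limit is the source of the threshold
  \<open>6/5 = 1 + 1/5\<close>.\<close>

lemma critical_order_at_0: "(critical_order \<longlongrightarrow> 1 / 5) (at_right 0)"
  unfolding critical_order_def by real_asymp

text \<open>The quotient \<open>f' / g'\<close> of the overview with the common factor
  \<open>p\<close> cancelled, so that it also makes sense for \<open>p = 0\<close>.\<close>

definition slope_ratio :: "real \<Rightarrow> real \<Rightarrow> real" where
  "slope_ratio p t = (t - sin t * cos t) / sin t ^ 3 * exp (p * (t * cot t - 1)) * cos t powr (1 - p)"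

lemma slope_ratio_at_0: "(slope_ratio p \<longlongrightarrow> 2 / 3) (at_right 0)"
proof -
  have "((\<lambda>t::real. (t - sin t * cos t) / sin t ^ 3) \<longlongrightarrow> 2/3) (at_right 0)" by real_asymp
  moreover have "((\<lambda>t. exp (p * (t * cot t - 1))) \<longlongrightarrow> exp (p * 0)) (at_right 0)"
    by (intro tendsto_intros) (unfold cot_def, real_asymp)
  moreover have "((\<lambda>t. cos t powr (1 - p)) \<longlongrightarrow> cos 0 powr (1 - p)) (at_right 0)"
    by (intro tendsto_intros) auto
  ultimately have "(slope_ratio p \<longlongrightarrow> 2/3 * exp (p * 0) * cos 0 powr (1-p)) (at_right 0)"
    unfolding slope_ratio_def by (intro tendsto_mult)
  then show ?thesis by simp
qed

lemma quadrant_facts: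
  fixes t :: real
  assumes "0 < t" "t < pi / 2"
  shows "0 < sin t" "0 < cos t" "0 < tan t - t" "0 < t - sin t * cos t" "0 < sin t - t * cos t"
proof -
  show s: "0 < sin t" and c: "0 < cos t" using assms by (auto intro: sin_gt_zero cos_gt_zero)
  show y: "0 < sin t - t * cos t" using x_cos_less_sin[of t] assms by auto
  then show "0 < tan t - t" using c by (simp add: tan_def field_simps)
  have "0 < 2 * t - sin (2 * t)"
    by (rule pos_of_deriv_pos[where f = "\<lambda>x. 2 * x - sin (2 * x)" and f' = "\<lambda>x. 4 * (sin x)\<^sup>2" and b = "pi/2"])
      (use assms in \<open>auto intro!: derivative_eq_intros simp: cos_double_sin sin_gt_zero less_imp_neq[symmetric]\<close>)
  then show "0 < t - sin t * cos t" by (simp add: sin_double)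
qed

lemma critical_numerator_pos:
  fixes t :: real
  assumes "0 < t" "t < pi / 2"
  shows "0 < t\<^sup>2 + t * sin t * cos t - 2 * (sin t)\<^sup>2"
  using critical_numerator_double_pos[of "2 * t", unfolded cos_double_sin sin_double power_mult_distrib] assms
  by (simp add: algebra_simps)

lemma critical_order_pos: "0 < t \<Longrightarrow> t < pi / 2 \<Longrightarrow> 0 < critical_order t"
  unfolding critical_order_def using critical_numerator_pos quadrant_facts by simp

lemma t_minus_sin_cos_deriv:
  "((\<lambda>t. t - sin t * cos t) has_real_derivative 2 * (sin t)\<^sup>2) (at t)" for t :: real
  using sin_cos_squared_add[of t]
  by (auto intro!: derivative_eq_intros simp: algebra_simps power2_eq_square)

text \<open>With \<open>V\<close>, \<open>Y = tan t - t\<close>, \<open>Z = t - sin t cos t\<close> the numerator and the two factors of the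
  denominator, compare the logarithmic derivatives with their leading terms:
  \<open>V'/V < 6/t\<close>, \<open>Y'/Y \<ge> 3/t + t/2\<close> and \<open>Z'/Z \<ge> 3/t - t/2\<close>.\<close>

lemma critical_order_deriv:
  assumes t: "0 < t" "t < pi / 2"
  shows "\<exists>D. (critical_order has_real_derivative D) (at t) \<and> D < 0"
proof -
  define s c T where "s = sin t" and "c = cos t" and "T = tan t"
  define V V' Y Z where "V = t\<^sup>2 + t * s * c - 2 * s\<^sup>2"
    and "V' = 3 * (t - s * c) - 2 * t * s\<^sup>2" and "Y = T - t" and "Z = t - s * c"
  define D' where "D' = T\<^sup>2 * Z + Y * (2 * s\<^sup>2)"
  note defs = s_def c_def T_def V_def V'_def Y_def Z_def
  have pos: "0 < s" "0 < c" "0 < Y" "0 < Z" "0 < V"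
    using quadrant_facts[OF t] critical_numerator_pos[OF t] by (simp_all add: defs)
  have c2: "c\<^sup>2 = 1 - s\<^sup>2" by (simp add: s_def c_def cos_squared_eq)
  have s: "s = T * c" using pos by (simp add: T_def s_def c_def tan_def)
  have E: "t * V' < 6 * V"
    using numerator_growth_double[of "2 * t", unfolded cos_double_sin sin_double power_mult_distrib] t
    by (simp add: V_def V'_def s_def c_def algebra_simps power2_eq_square)
  have "(6 - t\<^sup>2) * Z \<le> 4 * t * s\<^sup>2"
    using t_minus_sin_cos_growth_double[of "2 * t", unfolded cos_double_sin sin_double power_mult_distrib] t
    by (simp add: Z_def s_def c_def algebra_simps power2_eq_square power3_eq_cube)
  then have A: "(3 - t\<^sup>2 / 2) * Z \<le> t * (2 * s\<^sup>2)" by (simp add: algebra_simps)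
  \<comment> \<open>The bound \<open>B\<close> below, multiplied by \<open>cos^2 t\<close>; this
    removes the tangents, so that the double-angle inequality applies.\<close>
  have "0 \<le> t * s\<^sup>2 - (3 + t\<^sup>2 / 2) * (s * c - t * c\<^sup>2)"
    using tan_minus_t_growth_double[of "2 * t", unfolded cos_double_sin sin_double power_mult_distrib] t unfolding c2
    by (simp add: s_def c_def algebra_simps power2_eq_square power3_eq_cube)
  also have "\<dots> = c\<^sup>2 * (t * T\<^sup>2 - (3 + t\<^sup>2 / 2) * Y)"
    by (simp add: s Y_def field_simps power2_eq_square)
  finally have B: "(3 + t\<^sup>2 / 2) * Y \<le> t * T\<^sup>2"
    using pos by (simp add: zero_le_mult_iff)
  \<comment> \<open>\<open>D'\<close> is the derivative of \<open>Y Z\<close>. In \<open>Z\<close>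
    times \<open>B\<close> plus \<open>Y\<close> times \<open>A\<close> the terms with
    \<open>t^2 / 2\<close> cancel, leaving exactly the constant 6 that \<open>E\<close>
    beats.\<close>
  have "6 * (Y * Z) \<le> t * D'"
    using mult_right_mono[OF B, of Z] mult_right_mono[OF A, of Y] pos by (simp add: D'_def algebra_simps)
  then have "V * (6 * (Y * Z)) \<le> V * (t * D')" using pos by (intro mult_left_mono) auto
  moreover have "t * V' * (Y * Z) < 6 * V * (Y * Z)" using E pos by (intro mult_strict_right_mono) auto
  ultimately have "t * (V' * (Y * Z) - V * D') < 0" by (simp add: algebra_simps)
  then have neg: "V' * (Y * Z) - V * D' < 0" using t by (simp add: mult_less_0_iff)
  have dT: "(tan has_real_derivative 1 + (tan t)\<^sup>2) (at t)"
    using DERIV_tan[of t] tan_sec[of t] pos by (simp add: c_def power_inverse)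
  have dV: "((\<lambda>t. t\<^sup>2 + t * sin t * cos t - 2 * (sin t)\<^sup>2) has_real_derivative V') (at t)"
  proof -
    have "((\<lambda>t. t\<^sup>2 + t * sin t * cos t - 2 * (sin t)\<^sup>2) has_real_derivative
        2 * t + s * c + t * (c * c - s * s) - 4 * s * c) (at t)"
      by (auto intro!: derivative_eq_intros simp: s_def c_def algebra_simps)
    moreover have "2 * t + s * c + t * (c * c - s * s) - 4 * s * c = V'"
      unfolding V'_def using c2 by algebra
    ultimately show ?thesis by simp
  qed
  have dY: "((\<lambda>t. tan t - t) has_real_derivative T\<^sup>2) (at t)"
    using DERIV_diff[OF dT DERIV_ident] by (simp add: T_def)
  have dZ: "((\<lambda>t. t - sin t * cos t) has_real_derivative 2 * s\<^sup>2) (at t)"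
    unfolding s_def by (rule t_minus_sin_cos_deriv)
  have "(critical_order has_real_derivative (V' * (Y * Z) - V * D') / (Y * Z * (Y * Z))) (at t)"
    unfolding critical_order_def[abs_def]
    using DERIV_divide[OF dV DERIV_mult[OF dY dZ]] pos by (simp add: defs D'_def mult_ac)
  moreover have "(V' * (Y * Z) - V * D') / (Y * Z * (Y * Z)) < 0"
    using neg pos by (intro divide_neg_pos) auto
  ultimately show ?thesis by blast
qed

lemma critical_order_strict_antimono:
  assumes "0 < x" "x < y" "y < pi / 2"
  shows "critical_order y < critical_order x"
  by (rule DERIV_neg_imp_decreasing) (use assms critical_order_deriv in auto)

lemma slope_ratio_pos: "0 < t \<Longrightarrow> t < pi / 2 \<Longrightarrow> 0 < slope_ratio p t"
  unfolding slope_ratio_def using quadrant_facts[of t] by (intro mult_pos_pos divide_pos_pos) auto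

lemma exponent_deriv:
  fixes t :: real
  assumes "sin t \<noteq> 0"
  shows "((\<lambda>t. t * cot t - 1) has_real_derivative - (t - sin t * cos t) / (sin t)\<^sup>2) (at t)"
proof -
  have "((\<lambda>t. t * cot t - 1) has_real_derivative cot t - t * inverse ((sin t)\<^sup>2)) (at t)"
    by (rule derivative_eq_intros DERIV_cot refl assms)+ (simp add: algebra_simps)
  moreover have "cot t - t * inverse ((sin t)\<^sup>2) = - (t - sin t * cos t) / (sin t)\<^sup>2"
    using assms by (simp add: cot_def field_simps power2_eq_square)
  ultimately show ?thesis by simp
qed

text \<open>The logarithmic derivative is affine in \<open>p\<close>. Its coefficient of
  \<open>p\<close> is the positive factor \<open>(sin t - t cos t) / (sin^2 t cos t)\<close> and its
  zero is \<open>1 + critical_order t\<close>.\<close>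

lemma slope_ratio_deriv:
  assumes t: "0 < t" "t < pi / 2"
  shows "(slope_ratio p has_real_derivative
      slope_ratio p t * ((sin t - t * cos t) / ((sin t)\<^sup>2 * cos t) * (p - 1 - critical_order t))) (at t)"
proof -
  define s c where "s = sin t" and "c = cos t"
  have pos: "0 < s" "0 < c" "0 < t - s * c" "0 < s - t * c"
    using quadrant_facts[OF t] by (simp_all add: s_def c_def)
  have c2: "c\<^sup>2 = 1 - s\<^sup>2" by (simp add: s_def c_def cos_squared_eq)
  have d1: "((\<lambda>t. (t - sin t * cos t) / sin t ^ 3) has_real_derivative
      2 / s - 3 * c * (t - s * c) / s ^ 4) (at t)"
    by (rule derivative_eq_intros t_minus_sin_cos_deriv refl)+
      (use pos in \<open>simp_all add: s_def[symmetric] c_def[symmetric] field_simps eval_nat_numeral\<close>)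
  have d2: "((\<lambda>t. exp (p * (t * cot t - 1))) has_real_derivative
      exp (p * (t * cot t - 1)) * (- p * (t - s * c) / s\<^sup>2)) (at t)"
    by (rule DERIV_cong[OF DERIV_fun_exp[OF DERIV_cmult[OF exponent_deriv]]])
      (use pos in \<open>simp_all add: s_def c_def field_simps\<close>)
  have d3: "((\<lambda>t. cos t powr (1 - p)) has_real_derivative c powr (1 - p) * (- (1 - p) * s / c)) (at t)"
    by (rule DERIV_cong[OF DERIV_fun_powr[OF DERIV_cos]])
      (use pos in \<open>simp_all add: s_def c_def powr_diff powr_minus field_simps\<close>)
  have ev: "slope_ratio p t = (t - s * c) / s ^ 3 * exp (p * (t * cot t - 1)) * c powr (1 - p)"
    by (simp add: slope_ratio_def s_def c_def)
  have "tan t - t = (s - t * c) / c" using pos by (simp add: tan_def s_def c_def field_simps)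
  then have cr: "critical_order t = c * (t\<^sup>2 + t * s * c - 2 * s\<^sup>2) / ((s - t * c) * (t - s * c))"
    by (simp add: critical_order_def s_def c_def)
  have key: "2 / s - 3 * c * (t - s * c) / s ^ 4 + (t - s * c) / s ^ 3 * (- p * (t - s * c) / s\<^sup>2 + - (1 - p) * s / c)
    = (t - s * c) / s ^ 3 * ((s - t * c) / (s\<^sup>2 * c) * (p - 1 - critical_order t))"
  proof -
    define y z V where "y = s - t * c" and "z = t - s * c" and "V = t\<^sup>2 + t * s * c - 2 * s\<^sup>2"
    have yz: "y \<noteq> 0" "z \<noteq> 0" "s \<noteq> 0" "c \<noteq> 0" using pos by (auto simp: y_def z_def)
    \<comment> \<open>The numerators of \<open>key\<close> over the common denominator
      \<open>s^5 c\<close>: a polynomial identity modulo \<open>c^2 + s^2 = 1\<close>.\<close>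
    have pol: "2 * s ^ 4 * c - 3 * c\<^sup>2 * z * s - p * z\<^sup>2 * c - (1 - p) * z * s ^ 3 = z * y * (p - 1) - c * V"
      unfolding y_def z_def V_def using c2 by algebra
    have "2 / s - 3 * c * z / s ^ 4 + z / s ^ 3 * (- p * z / s\<^sup>2 + - (1 - p) * s / c)
        = (2 * s ^ 4 * c - 3 * c\<^sup>2 * z * s - p * z\<^sup>2 * c - (1 - p) * z * s ^ 3) / (s ^ 5 * c)"
      using yz by (simp add: field_simps eval_nat_numeral)
    also have "\<dots> = z / s ^ 3 * (y / (s\<^sup>2 * c) * (p - 1 - c * V / (y * z)))"
      unfolding pol using yz by (simp add: field_simps eval_nat_numeral)
    finally show ?thesis unfolding cr y_def z_def V_def .
  qed
  \<comment> \<open>Shape of the product rule for \<open>Q E C\<close>: \<open>A\<close> is the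
    derivative of \<open>Q\<close>, while \<open>B\<close> and \<open>B'\<close> are the logarithmic
    derivatives of the exponential \<open>E\<close> and the power \<open>C\<close>. Thus
    \<open>key\<close> is all that remains.\<close>
  have product: "(A * E + E * B * Q) * C + C * B' * (Q * E) = Q * E * C * K"
    if "A + Q * (B + B') = Q * K" for A B B' C E K Q :: real
  proof -
    have "(A * E + E * B * Q) * C + C * B' * (Q * E) = (A + Q * (B + B')) * (E * C)"
      by (simp add: algebra_simps)
    then show ?thesis by (simp add: that)
  qed
  show ?thesis
    unfolding slope_ratio_def[abs_def]
    by (rule DERIV_cong[OF DERIV_mult[OF DERIV_mult[OF d1 d2] d3]],
        unfold slope_ratio_def[symmetric] ev s_def[symmetric] c_def[symmetric], rule product[OF key])
qed

text \<open>Because \<open>critical_order\<close> decreases, comparing it with \<open>p - 1\<close>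
  at the left endpoint settles the whole interval. In the decreasing case the right endpoint does
  this.\<close>

lemma slope_ratio_increasing:
  assumes "0 < x" "x < y" "y < pi / 2" "critical_order x \<le> p - 1"
  shows "slope_ratio p x < slope_ratio p y"
proof (rule DERIV_pos_imp_increasing_open[OF \<open>x < y\<close>])
  fix t assume t: "x < t" "t < y"
  then have "0 < t" "t < pi / 2" "critical_order t < p - 1"
    using assms critical_order_strict_antimono[of x t] by auto
  moreover from this have "0 < slope_ratio p t * ((sin t - t * cos t) / ((sin t)\<^sup>2 * cos t) * (p - 1 - critical_order t))"
    using slope_ratio_pos[of t p] quadrant_facts[of t] by (intro mult_pos_pos divide_pos_pos) auto
  ultimately show "\<exists>D. (slope_ratio p has_real_derivative D) (at t) \<and> 0 < D"
    using slope_ratio_deriv[of t p] by blast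
next
  show "continuous_on {x..y} (slope_ratio p)"
    using assms by (intro DERIV_continuous_on[OF has_field_derivative_at_within[OF slope_ratio_deriv]]) auto
qed

lemma slope_ratio_decreasing:
  assumes "0 < x" "x < y" "y < pi / 2" "p - 1 \<le> critical_order y"
  shows "slope_ratio p y < slope_ratio p x"
proof (rule DERIV_neg_imp_decreasing_open[OF \<open>x < y\<close>])
  fix t assume t: "x < t" "t < y"
  then have "0 < t" "t < pi / 2" "p - 1 < critical_order t"
    using assms critical_order_strict_antimono[of t y] by auto
  moreover from this have "slope_ratio p t * ((sin t - t * cos t) / ((sin t)\<^sup>2 * cos t) * (p - 1 - critical_order t)) < 0"
    using slope_ratio_pos[of t p] quadrant_facts[of t] by (intro mult_pos_neg divide_pos_pos) auto
  ultimately show "\<exists>D. (slope_ratio p has_real_derivative D) (at t) \<and> D < 0"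
    using slope_ratio_deriv[of t p] by blast
next
  show "continuous_on {x..y} (slope_ratio p)"
    using assms by (intro DERIV_continuous_on[OF has_field_derivative_at_within[OF slope_ratio_deriv]]) auto
qed

section \<open>Signs from one-sided limits and monotonicity\<close>

lemma right_limit_less:
  fixes f :: "real \<Rightarrow> real"
  assumes lim: "(f \<longlongrightarrow> l) (at_right a)" and "a < t"
    and mono: "\<And>x y. a < x \<Longrightarrow> x < y \<Longrightarrow> y \<le> t \<Longrightarrow> f x < f y"
  shows "l < f t"
proof -
  \<comment> \<open>Passing to the limit gives only a weak inequality at the midpoint; moving on
    from there to \<open>t\<close> restores strictness.\<close>
  let ?m = "(a + t) / 2"
  have "\<forall>\<^sub>F x in at_right a. f x \<le> f ?m"
    using \<open>a < t\<close> by (intro eventually_at_rightI[of a ?m] less_imp_le mono) auto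
  then have "l \<le> f ?m" by (intro tendsto_upperbound[OF lim]) auto
  then show ?thesis using mono[of ?m t] \<open>a < t\<close> by simp
qed

lemma right_limit_greater:
  fixes f :: "real \<Rightarrow> real"
  assumes "(f \<longlongrightarrow> l) (at_right a)" "a < t"
    and "\<And>x y. a < x \<Longrightarrow> x < y \<Longrightarrow> y \<le> t \<Longrightarrow> f y < f x"
  shows "f t < l"
  using right_limit_less[of "\<lambda>x. - f x" "- l" a t] assms by (auto intro: tendsto_minus)

lemma critical_order_less:
  assumes "0 < t" "t < pi / 2"
  shows "critical_order t < 1 / 5"
  by (rule right_limit_greater[OF critical_order_at_0]) (use assms critical_order_strict_antimono in auto)

text \<open>The hypothesis passes from \<open>t\<close> to all smaller points, so
  \<open>slope_ratio p\<close> descends from its limit \<open>2/3\<close> all the way to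
  \<open>t\<close>.\<close>

lemma slope_ratio_less:
  assumes "0 < t" "t < pi / 2" "p - 1 \<le> critical_order t"
  shows "slope_ratio p t < 2 / 3"
proof (rule right_limit_greater[OF slope_ratio_at_0 \<open>0 < t\<close>])
  fix x y assume "0 < x" "x < y" "y \<le> t"
  moreover have "critical_order t \<le> critical_order y"
    using critical_order_strict_antimono[of y t] calculation assms by (cases "y = t") auto
  ultimately show "slope_ratio p y < slope_ratio p x"
    using assms by (intro slope_ratio_decreasing) auto
qed

lemma right_limit_zero_pos:
  fixes f f' :: "real \<Rightarrow> real"
  assumes lim: "(f \<longlongrightarrow> 0) (at_right a)" and "a < t" "t < b"
    and d: "\<And>x. a < x \<Longrightarrow> x < b \<Longrightarrow> (f has_real_derivative f' x) (at x)"
    and pos: "\<And>x. a < x \<Longrightarrow> x < b \<Longrightarrow> 0 < f' x"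
  shows "0 < f t"
proof (rule right_limit_less[OF lim \<open>a < t\<close>])
  fix x y assume "a < x" "x < y" "y \<le> t"
  then show "f x < f y"
    using d pos \<open>t < b\<close> by (intro DERIV_pos_imp_increasing[of x y f]) force+
qed

lemma right_limit_zero_neg:
  fixes f f' :: "real \<Rightarrow> real"
  assumes "(f \<longlongrightarrow> 0) (at_right a)" "a < t" "t < b"
    and "\<And>x. a < x \<Longrightarrow> x < b \<Longrightarrow> (f has_real_derivative f' x) (at x)"
    and "\<And>x. a < x \<Longrightarrow> x < b \<Longrightarrow> f' x < 0"
  shows "f t < 0"
  using right_limit_zero_pos[of "\<lambda>x. - f x" a t b "\<lambda>x. - f' x"] tendsto_minus[OF assms(1)] assms(2-)
  by (auto intro: DERIV_minus)

text \<open>If \<open>f t \<ge> 0\<close>, the mean value theorem gives a point left of \<open>t\<close> where \<open>f' \<ge> 0\<close> and, since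
  \<open>f\<close> returns to \<open>L \<le> 0\<close>, a point right of \<open>t\<close> where \<open>f' \<le> 0\<close>.\<close>

lemma neg_between_limits:
  fixes f f' :: "real \<Rightarrow> real"
  assumes lim: "(f \<longlongrightarrow> 0) (at_right a)" and lim_b: "(f \<longlongrightarrow> L) (at_left b)" and "L \<le> 0"
    and t: "a < t" "t < b"
    and d: "\<And>x. a < x \<Longrightarrow> x < b \<Longrightarrow> (f has_real_derivative f' x) (at x)"
    and sign: "\<And>x y. a < x \<Longrightarrow> x < y \<Longrightarrow> y < b \<Longrightarrow> 0 \<le> f' x \<Longrightarrow> 0 < f' y"
  shows "f t < 0"
proof (rule ccontr)
  assume "\<not> f t < 0"
  have "\<exists>x. a < x \<and> x < t \<and> 0 \<le> f' x"
  proof (rule ccontr)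
    assume none: "\<not> ?thesis"
    have "f t < 0"
    proof (rule right_limit_greater[OF lim t(1)])
      fix x y assume xy: "a < x" "x < y" "y \<le> t"
      show "f y < f x"
      proof (rule DERIV_neg_imp_decreasing_open[OF \<open>x < y\<close>])
        show "\<exists>D. (f has_real_derivative D) (at z) \<and> D < 0" if "x < z" "z < y" for z
          using none d[of z] that xy t by (intro exI[of _ "f' z"]) (auto simp: not_le)
        show "continuous_on {x..y} f"
          using xy t by (intro DERIV_continuous_on[OF has_field_derivative_at_within[OF d]]) auto
      qed
    qed
    with \<open>\<not> f t < 0\<close> show False by simp
  qed
  then obtain x where x: "a < x" "x < t" "0 \<le> f' x" by blast
  have incr: "f y < f z" if "t \<le> y" "y < z" "z < b" for y z
    using that x t d sign[OF x(1) _ _ x(3)] by (intro DERIV_pos_imp_increasing[OF \<open>y < z\<close>]) force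
  \<comment> \<open>From \<open>t\<close> on \<open>f\<close> increases, hence
    \<open>L \<ge> f ?m > f t \<ge> 0\<close>, against \<open>L \<le> 0\<close>.\<close>
  let ?m = "(t + b) / 2"
  have "\<forall>\<^sub>F z in at_left b. f ?m \<le> f z"
    using t by (intro eventually_at_leftI[of ?m b] less_imp_le incr) auto
  then have "f ?m \<le> L" by (intro tendsto_lowerbound[OF lim_b]) auto
  then show False using incr[of t ?m] t \<open>L \<le> 0\<close> \<open>\<not> f t < 0\<close> by simp
qed

section \<open>The gap function, its derivative and its limits\<close>

text \<open>The function \<open>f - l g\<close>; at \<open>p = 0\<close> it is the limit, so that one derivative formula covers all \<open>p\<close>.\<close>

definition gap :: "real \<Rightarrow> real \<Rightarrow> real \<Rightarrow> real" where
  "gap p l t = (if p = 0 then - (t * cot t - 1) + l * ln (cos t)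
     else (1 - exp (p * (t * cot t - 1)) - l * (1 - cos t powr p)) / p)"

lemma gap_deriv:
  assumes t: "0 < t" "t < pi / 2"
  shows "(gap p l has_real_derivative cos t powr (p - 1) * sin t * (slope_ratio p t - l)) (at t)"
proof -
  have pos: "0 < sin t" "0 < cos t" using quadrant_facts[OF t] by auto
  define E where "E = exp (p * (t * cot t - 1))"
  \<comment> \<open>This is \<open>g' \<rho> = f'\<close> in the notation of the overview.\<close>
  have w: "cos t powr (p - 1) * sin t * slope_ratio p t = (t - sin t * cos t) / (sin t)\<^sup>2 * E"
    using pos by (simp add: slope_ratio_def E_def powr_diff field_simps eval_nat_numeral)
  show ?thesis
  proof (cases "p = 0")
    case True
    have "((\<lambda>t. l * ln (cos t)) has_real_derivative - (l * sin t / cos t)) (at t)"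
      using pos by (auto intro!: derivative_eq_intros)
    then have "((\<lambda>t. - (t * cot t - 1) + l * ln (cos t)) has_real_derivative
        - (- (t - sin t * cos t) / (sin t)\<^sup>2) + - (l * sin t / cos t)) (at t)"
      using pos by (intro DERIV_add DERIV_minus exponent_deriv) auto
    moreover have "- (- (t - sin t * cos t) / (sin t)\<^sup>2) + - (l * sin t / cos t)
        = cos t powr (p - 1) * sin t * (slope_ratio p t - l)"
      unfolding right_diff_distrib w using True pos by (simp add: E_def powr_minus_divide diff_divide_distrib)
    ultimately show ?thesis using True by (simp only: gap_def[abs_def] simp_thms if_True)
  next
    case False
    have "((\<lambda>t. exp (p * (t * cot t - 1))) has_real_derivative
        E * (p * (- (t - sin t * cos t) / (sin t)\<^sup>2))) (at t)"
      unfolding E_def using pos by (intro DERIV_fun_exp DERIV_cmult exponent_deriv) auto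
    moreover have "((\<lambda>t. l * (1 - cos t powr p)) has_real_derivative
        l * (p * (cos t powr (p - 1) * sin t))) (at t)"
      using pos by (auto intro!: derivative_eq_intros)
    ultimately have "((\<lambda>t. (1 - exp (p * (t * cot t - 1)) - l * (1 - cos t powr p)) / p)
        has_real_derivative (0 - E * (p * (- (t - sin t * cos t) / (sin t)\<^sup>2))
          - l * (p * (cos t powr (p - 1) * sin t))) / p) (at t)"
      by (intro DERIV_cdivide DERIV_diff DERIV_const)
    moreover have "(0 - E * (p * (- (t - sin t * cos t) / (sin t)\<^sup>2))
          - l * (p * (cos t powr (p - 1) * sin t))) / p
        = cos t powr (p - 1) * sin t * slope_ratio p t - l * (cos t powr (p - 1) * sin t)"
      unfolding w using False pos by (simp add: field_simps)
    ultimately show ?thesis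
      using False unfolding gap_def[abs_def] right_diff_distrib by (simp add: mult.commute[of l])
  qed
qed

lemma gap_at_0: "(gap p l \<longlongrightarrow> 0) (at_right 0)"
proof -
  have h: "((\<lambda>t::real. t * cot t - 1) \<longlongrightarrow> 0) (at_right 0)" unfolding cot_def by real_asymp
  have c: "(cos \<longlongrightarrow> (1::real)) (at_right 0)" by real_asymp
  show ?thesis
  proof (cases "p = 0")
    case True
    have "((\<lambda>t. - (t * cot t - 1) + l * ln (cos t)) \<longlongrightarrow> - 0 + l * ln 1) (at_right 0)"
      by (rule tendsto_intros h c)+ auto
    then show ?thesis using True by (simp add: gap_def[abs_def])
  next
    case False
    have "((\<lambda>t. (1 - exp (p * (t * cot t - 1)) - l * (1 - cos t powr p)) / p)
        \<longlongrightarrow> (1 - exp (p * 0) - l * (1 - 1 powr p)) / p) (at_right 0)"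
      by (rule tendsto_intros h c)+ (use False in auto)
    then show ?thesis using False by (simp add: gap_def[abs_def])
  qed
qed

lemma exponent_at_pi_half: "((\<lambda>t. t * cot t - 1) \<longlongrightarrow> - 1) (at_left (pi / 2))"
proof -
  have "((\<lambda>t. t * cot t - 1) \<longlongrightarrow> pi / 2 * cot (pi / 2) - 1) (at_left (pi / 2))"
    by (intro tendsto_intros) auto
  then show ?thesis by (simp add: cot_def)
qed

lemma cos_powr_at_pi_half:
  assumes "0 < p"
  shows "((\<lambda>t. cos t powr p) \<longlongrightarrow> 0) (at_left (pi / 2))"
proof -
  have "\<forall>\<^sub>F t in at_left (pi / 2). 0 \<le> cos t"
    by (intro eventually_at_leftI[of 0]) (auto intro!: cos_ge_zero)
  moreover have "(cos \<longlongrightarrow> cos (pi / 2)) (at_left (pi / 2))" by (intro tendsto_intros)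
  ultimately have "((\<lambda>t. cos t powr p) \<longlongrightarrow> cos (pi / 2) powr p) (at_left (pi / 2))"
    using assms by (intro tendsto_powr' tendsto_const) auto
  then show ?thesis by simp
qed

text \<open>Source of two constants: the limit is 0 exactly for \<open>l = 1 - exp (- p)\<close>,
  and for \<open>l = 2/3\<close> it is nonpositive exactly when \<open>p \<le> ln 3\<close>.\<close>

lemma gap_at_pi_half:
  assumes "0 < p"
  shows "(gap p l \<longlongrightarrow> (1 - exp (- p) - l) / p) (at_left (pi / 2))"
proof -
  have "((\<lambda>t. (1 - exp (p * (t * cot t - 1)) - l * (1 - cos t powr p)) / p)
      \<longlongrightarrow> (1 - exp (p * (- 1)) - l * (1 - 0)) / p) (at_left (pi / 2))"
    by (rule tendsto_intros exponent_at_pi_half cos_powr_at_pi_half assms)+ (use assms in auto)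
  then show ?thesis using assms by (simp add: gap_def[abs_def])
qed

lemma gap_weight_pos: "0 < t \<Longrightarrow> t < pi / 2 \<Longrightarrow> 0 < cos t powr (p - 1) * sin t"
  using quadrant_facts[of t] by simp

section \<open>Sign of the gap for the extreme coefficients\<close>

text \<open>Here \<open>critical_order\<close> stays below \<open>1/5 \<le> p - 1\<close>, so the
  ratio increases from \<open>2/3\<close> and the gap increases from 0.\<close>

lemma gap_two_thirds_pos:
  assumes "6 / 5 \<le> p" "0 < t" "t < pi / 2"
  shows "0 < gap p (2 / 3) t"
proof (rule right_limit_zero_pos[OF gap_at_0 assms(2,3) gap_deriv])
  fix x :: real assume x: "0 < x" "x < pi / 2"
  have "2 / 3 < slope_ratio p x"
  proof (rule right_limit_less[OF slope_ratio_at_0 x(1)])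
    fix y z assume "0 < y" "y < z" "z \<le> x"
    then show "slope_ratio p y < slope_ratio p z"
      using x assms critical_order_less[of y] by (intro slope_ratio_increasing) auto
  qed
  then show "0 < cos x powr (p - 1) * sin x * (slope_ratio p x - 2 / 3)"
    by (intro mult_pos_pos[OF gap_weight_pos[OF x]]) simp
qed

lemma one_le_ln_3: "1 \<le> ln (3::real)"
  using exp_le by (simp add: ln_ge_iff)

text \<open>For \<open>p \<le> 1\<close> the ratio stays below \<open>2/3\<close>. For
  \<open>1 < p \<le> ln 3\<close> it may cross \<open>2/3\<close>, but only once and upwards, and
  the gap ends at a nonpositive limit.\<close>

lemma gap_two_thirds_neg:
  assumes "p \<le> ln 3" "0 < t" "t < pi / 2"
  shows "gap p (2 / 3) t < 0"
proof (cases "p \<le> 1")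
  case True
  show ?thesis
  proof (rule right_limit_zero_neg[OF gap_at_0 assms(2,3) gap_deriv])
    fix x :: real assume x: "0 < x" "x < pi / 2"
    have "slope_ratio p x < 2 / 3"
      using True critical_order_pos[OF x] by (intro slope_ratio_less x) auto
    then show "cos x powr (p - 1) * sin x * (slope_ratio p x - 2 / 3) < 0"
      by (intro mult_pos_neg[OF gap_weight_pos[OF x]]) simp
  qed
next
  case False
  have "exp p \<le> 3" using assms by (metis exp_le_cancel_iff exp_ln zero_less_numeral)
  then have "1 / 3 \<le> exp (- p)" by (simp add: exp_minus field_simps)
  then have L: "(1 - exp (- p) - 2 / 3) / p \<le> 0" using False by (intro divide_nonpos_pos) auto
  show ?thesis
  proof (rule neg_between_limits[OF gap_at_0 gap_at_pi_half L assms(2,3) gap_deriv])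
    fix x y :: real
    assume xy: "0 < x" "x < y" "y < pi / 2"
      and "0 \<le> cos x powr (p - 1) * sin x * (slope_ratio p x - 2 / 3)"
    then have ge: "2 / 3 \<le> slope_ratio p x"
      using gap_weight_pos[of x p] by (simp add: zero_le_mult_iff)
    \<comment> \<open>Otherwise the ratio would still be in its decreasing phase at
      \<open>x\<close>, hence below \<open>2/3\<close>.\<close>
    then have "critical_order x \<le> p - 1" using slope_ratio_less[of x p] xy by force
    then have "2 / 3 < slope_ratio p y" using slope_ratio_increasing[of x y p] ge xy by simp
    then show "0 < cos y powr (p - 1) * sin y * (slope_ratio p y - 2 / 3)"
      using xy by (intro mult_pos_pos[OF gap_weight_pos]) auto
  qed (use False in auto)
qed

text \<open>The ratio increases, so it stays above \<open>l\<close> once it reaches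
  \<open>l\<close>, and this \<open>l\<close> makes the gap return to 0 at \<open>pi / 2\<close>.
  \<open>gap_end_pos\<close> is the mirror image, with a decreasing ratio.\<close>

lemma gap_end_neg:
  assumes "6 / 5 \<le> p" "0 < t" "t < pi / 2"
  shows "gap p (1 - exp (- p)) t < 0"
proof (rule neg_between_limits[OF gap_at_0 gap_at_pi_half _ assms(2,3) gap_deriv])
  fix x y :: real
  assume xy: "0 < x" "x < y" "y < pi / 2"
    and "0 \<le> cos x powr (p - 1) * sin x * (slope_ratio p x - (1 - exp (- p)))"
  then have "1 - exp (- p) \<le> slope_ratio p x"
    using gap_weight_pos[of x p] by (simp add: zero_le_mult_iff)
  then have "1 - exp (- p) < slope_ratio p y"
    using slope_ratio_increasing[of x y p] critical_order_less[of x] assms xy by simp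
  then show "0 < cos y powr (p - 1) * sin y * (slope_ratio p y - (1 - exp (- p)))"
    using xy by (intro mult_pos_pos[OF gap_weight_pos]) auto
qed (use assms in auto)

lemma gap_end_pos:
  assumes "0 < p" "p \<le> 1" "0 < t" "t < pi / 2"
  shows "0 < gap p (1 - exp (- p)) t"
proof -
  let ?l = "1 - exp (- p)"
  have lim_0: "((\<lambda>t. - gap p ?l t) \<longlongrightarrow> 0) (at_right 0)"
    using tendsto_minus[OF gap_at_0] by simp
  have lim_b: "((\<lambda>t. - gap p ?l t) \<longlongrightarrow> 0) (at_left (pi / 2))"
    using tendsto_minus[OF gap_at_pi_half[OF assms(1), of ?l]] by simp
  have "- gap p ?l t < 0"
  proof (rule neg_between_limits[OF lim_0 lim_b _ assms(3,4) DERIV_minus[OF gap_deriv]])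
    fix x y :: real
    assume xy: "0 < x" "x < y" "y < pi / 2"
      and le: "0 \<le> - (cos x powr (p - 1) * sin x * (slope_ratio p x - ?l))"
    have "slope_ratio p x \<le> ?l"
      using xy le mult_pos_pos[OF gap_weight_pos[of x p], of "slope_ratio p x - ?l"] by fastforce
    then have "slope_ratio p y < ?l"
      using slope_ratio_decreasing[of x y p] critical_order_pos[of y] assms xy by simp
    then show "0 < - (cos y powr (p - 1) * sin y * (slope_ratio p y - ?l))"
      using xy mult_pos_neg[OF gap_weight_pos[of y p], of "slope_ratio p y - ?l"] by simp
  qed auto
  then show ?thesis by simp
qed

section \<open>Sharpness of the constants\<close>

lemma gap_neg_near_0:
  assumes "\<forall>\<^sub>F t in at_right 0. slope_ratio p t < l"
  shows "\<exists>t\<in>{0<..<pi / 2}. gap p l t < 0"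
proof -
  obtain b where b: "0 < b" "\<And>x. 0 < x \<Longrightarrow> x < b \<Longrightarrow> slope_ratio p x < l"
    using assms unfolding eventually_at_right_field by auto
  define d where "d = min b (pi / 2)"
  have d: "0 < d" "d \<le> b" "d \<le> pi / 2" using b(1) by (auto simp: d_def)
  have "gap p l (d / 2) < 0"
  proof (rule right_limit_zero_neg[OF gap_at_0 _ _ gap_deriv])
    fix x assume "0 < x" "x < d"
    then show "cos x powr (p - 1) * sin x * (slope_ratio p x - l) < 0"
      using b d by (intro mult_pos_neg[OF gap_weight_pos]) auto
  qed (use d in auto)
  then show ?thesis using d by (intro bexI[of _ "d / 2"]) auto
qed

lemma gap_pos_near_0:
  assumes "\<forall>\<^sub>F t in at_right 0. l < slope_ratio p t"
  shows "\<exists>t\<in>{0<..<pi / 2}. 0 < gap p l t"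
proof -
  obtain b where b: "0 < b" "\<And>x. 0 < x \<Longrightarrow> x < b \<Longrightarrow> l < slope_ratio p x"
    using assms unfolding eventually_at_right_field by auto
  define d where "d = min b (pi / 2)"
  have d: "0 < d" "d \<le> b" "d \<le> pi / 2" using b(1) by (auto simp: d_def)
  have "0 < gap p l (d / 2)"
  proof (rule right_limit_zero_pos[OF gap_at_0 _ _ gap_deriv])
    fix x assume "0 < x" "x < d"
    then show "0 < cos x powr (p - 1) * sin x * (slope_ratio p x - l)"
      using b d by (intro mult_pos_pos[OF gap_weight_pos]) auto
  qed (use d in auto)
  then show ?thesis using d by (intro bexI[of _ "d / 2"]) auto
qed

text \<open>If \<open>l < 2/3\<close>, the ratio exceeds \<open>l\<close> near 0, so the gap starts
  out positive.\<close>

lemma gap_all_neg_imp_ge: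
  assumes "\<And>t. t \<in> {0<..<pi / 2} \<Longrightarrow> gap p l t < 0"
  shows "2 / 3 \<le> l"
  using gap_pos_near_0[of l p] order_tendstoD(1)[OF slope_ratio_at_0, of l p] assms
  by fastforce

lemma gap_all_pos_imp_le:
  assumes "\<And>t. t \<in> {0<..<pi / 2} \<Longrightarrow> 0 < gap p l t"
  shows "l \<le> 2 / 3"
  using gap_neg_near_0[of p l] order_tendstoD(2)[OF slope_ratio_at_0, of l p] assms
  by fastforce

lemma gap_all_neg_imp_ge_end:
  assumes "0 < p" "\<And>t. t \<in> {0<..<pi / 2} \<Longrightarrow> gap p l t < 0"
  shows "1 - exp (- p) \<le> l"
proof -
  have "\<forall>\<^sub>F t in at_left (pi / 2). gap p l t \<le> 0"
    using assms(2) by (intro eventually_at_leftI[of 0]) (auto intro: less_imp_le)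
  then have "(1 - exp (- p) - l) / p \<le> 0"
    by (intro tendsto_upperbound[OF gap_at_pi_half[OF assms(1)]]) auto
  then show ?thesis using assms(1) by (simp add: divide_le_0_iff)
qed

lemma gap_all_pos_imp_le_end:
  assumes "0 < p" "\<And>t. t \<in> {0<..<pi / 2} \<Longrightarrow> 0 < gap p l t"
  shows "l \<le> 1 - exp (- p)"
proof -
  have "\<forall>\<^sub>F t in at_left (pi / 2). 0 \<le> gap p l t"
    using assms(2) by (intro eventually_at_leftI[of 0]) (auto intro: less_imp_le)
  then have "0 \<le> (1 - exp (- p) - l) / p"
    by (intro tendsto_lowerbound[OF gap_at_pi_half[OF assms(1)]]) auto
  then show ?thesis using assms(1) by (simp add: zero_le_divide_iff)
qed

text \<open>At \<open>l = 2/3\<close> the limit of the ratio decides nothing. What decides is that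
  \<open>critical_order\<close> exceeds \<open>p - 1\<close> near 0, so the ratio approaches
  \<open>2/3\<close> from below.\<close>

lemma gap_two_thirds_neg_near_0:
  assumes "p < 6 / 5"
  shows "\<exists>t\<in>{0<..<pi / 2}. gap p (2 / 3) t < 0"
proof (rule gap_neg_near_0)
  have "\<forall>\<^sub>F t in at_right 0. p - 1 < critical_order t"
    using assms by (intro order_tendstoD(1)[OF critical_order_at_0]) simp
  moreover have "\<forall>\<^sub>F t in at_right 0. t \<in> {0<..<pi / 2}"
    by (intro eventually_at_right_real) simp
  ultimately show "\<forall>\<^sub>F t in at_right 0. slope_ratio p t < 2 / 3"
    by eventually_elim (rule slope_ratio_less, auto)
qed

text \<open>The factor \<open>(1 - cos^p t) / p\<close> that multiplies \<open>l\<close> is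
  nonnegative for either sign of \<open>p\<close>. This carries the sign at an extreme coefficient
  over to all coefficients beyond it.\<close>

lemma gap_antimono:
  assumes "0 < t" "t < pi / 2" "l \<le> l'"
  shows "gap p l' t \<le> gap p l t"
proof -
  have c: "0 < cos t" "cos t \<le> 1" using assms quadrant_facts[of t] by auto
  consider "p = 0" | "0 < p" | "p < 0" by linarith
  then show ?thesis
  proof cases
    case 1
    then show ?thesis using c assms by (simp add: gap_def mult_right_mono_neg)
  next
    case 2
    moreover have "cos t powr p \<le> 1" using 2 c by (intro powr_le1) auto
    ultimately show ?thesis using assms by (simp add: gap_def divide_right_mono mult_right_mono)
  next
    case 3
    moreover have "1 \<le> cos t powr p" using 3 c powr_mono2'[of p "cos t" 1] by simp
    ultimately show ?thesis
      using assms by (simp add: gap_def divide_right_mono_neg mult_right_mono_neg)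
  qed
qed

lemma exponent_neg:
  assumes "0 < t" "t < pi / 2"
  shows "t * cot t - 1 < 0"
  using quadrant_facts[OF assms] by (simp add: cot_def field_simps)

lemma gap_zero_pos:
  assumes "p < 0" "0 < t" "t < pi / 2"
  shows "0 < gap p 0 t"
  using exponent_neg[OF assms(2,3)] assms(1) by (simp add: gap_def divide_neg_neg mult_neg_neg)

text \<open>For negative \<open>p\<close> the power \<open>cos^p t\<close> blows up at
  \<open>pi / 2\<close>. Multiplying the inequality by \<open>cos^(-p) t\<close> gives both sides
  finite limits, \<open>l\<close> and 0.\<close>

lemma gap_all_pos_imp_nonpos:
  assumes p: "p < 0" and "\<And>t. t \<in> {0<..<pi / 2} \<Longrightarrow> 0 < gap p l t"
  shows "l \<le> 0"
proof -
  let ?u = "\<lambda>t. cos t powr (- p)"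
  have u: "(?u \<longlongrightarrow> 0) (at_left (pi / 2))" using p by (intro cos_powr_at_pi_half) simp
  have "\<forall>\<^sub>F t in at_left (pi / 2). l * (1 - ?u t) \<le> (exp (p * (t * cot t - 1)) - 1) * ?u t"
  proof (intro eventually_at_leftI[of 0])
    fix t :: real assume t: "t \<in> {0<..<pi / 2}"
    then have c: "0 < cos t" using quadrant_facts[of t] by simp
    have "l * (cos t powr p - 1) \<le> exp (p * (t * cot t - 1)) - 1"
      using assms(2)[OF t] p by (simp add: gap_def zero_less_divide_iff algebra_simps)
    then have "l * (cos t powr p - 1) * ?u t \<le> (exp (p * (t * cot t - 1)) - 1) * ?u t"
      by (intro mult_right_mono) auto
    moreover have "(cos t powr p - 1) * ?u t = 1 - ?u t"
      using c by (simp add: powr_minus field_simps)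
    ultimately show "l * (1 - ?u t) \<le> (exp (p * (t * cot t - 1)) - 1) * ?u t"
      by (simp add: mult.assoc)
  qed simp
  moreover have "((\<lambda>t. l * (1 - ?u t)) \<longlongrightarrow> l * (1 - 0)) (at_left (pi / 2))"
    by (intro tendsto_intros u)
  moreover have "((\<lambda>t. (exp (p * (t * cot t - 1)) - 1) * ?u t) \<longlongrightarrow> (exp (p * (- 1)) - 1) * 0)
      (at_left (pi / 2))"
    by (rule tendsto_intros u exponent_at_pi_half)+
  ultimately have "l * (1 - 0) \<le> (exp (p * (- 1)) - 1) * 0"
    by (intro tendsto_le[of "at_left (pi / 2)"]) auto
  then show ?thesis by simp
qed

section \<open>Translation of the bounds and means into gaps\<close>

lemma two_sided_bound_iff_pos:
  assumes "0 < p"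
  shows "two_sided_bound p \<alpha> \<beta> \<longleftrightarrow> (\<forall>t\<in>{0<..<pi / 2}. gap p \<alpha> t < 0 \<and> 0 < gap p \<beta> t)"
  unfolding two_sided_bound_def gap_def using assms
  by (intro ball_cong refl) (auto simp: divide_less_0_iff zero_less_divide_iff algebra_simps)

lemma two_sided_bound_iff_neg:
  assumes "p < 0"
  shows "two_sided_bound p \<alpha> \<beta> \<longleftrightarrow> (\<forall>t\<in>{0<..<pi / 2}. 0 < gap p \<alpha> t \<and> gap p \<beta> t < 0)"
  unfolding two_sided_bound_def gap_def using assms
  by (intro ball_cong refl) (auto simp: divide_less_0_iff zero_less_divide_iff algebra_simps)

text \<open>After taking logarithms, \<open>r h\<close> is compared with \<open>ln A\<close>.
  Extracting the \<open>r\<close>-th root reverses the comparison for negative \<open>r\<close>, and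
  so does the division by \<open>r\<close> in \<open>gap\<close>; the two effects match.\<close>

lemma power_mean_gap:
  assumes "0 < t" "t < pi / 2"
  shows "exp (t * cot t - 1) < power_mean r (cos t) 1 (2 / 3) \<longleftrightarrow> 0 < gap r (2 / 3) t"
    and "power_mean r (cos t) 1 (2 / 3) < exp (t * cot t - 1) \<longleftrightarrow> gap r (2 / 3) t < 0"
proof -
  define h A where "h = t * cot t - 1" and "A = 2 / 3 * cos t powr r + (1 - 2 / 3)"
  have c: "0 < cos t" using quadrant_facts[OF assms] by simp
  have A: "0 < A" using c by (simp add: A_def add_pos_pos)
  have g: "gap r (2 / 3) t = (A - exp (r * h)) / r" if "r \<noteq> 0"
    using that by (simp add: gap_def A_def h_def field_simps)
  have g0: "gap 0 (2 / 3) t = 2 / 3 * ln (cos t) - h" by (simp add: gap_def h_def)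
  have m: "power_mean r (cos t) 1 (2 / 3) = exp (ln A / r)" if "r \<noteq> 0"
    using that A by (simp add: power_mean_def A_def powr_def)
  have e: "exp (r * h) < A \<longleftrightarrow> r * h < ln A" "A < exp (r * h) \<longleftrightarrow> ln A < r * h"
    using A by (metis exp_less_cancel_iff exp_ln)+
  have z: "power_mean 0 (cos t) 1 (2 / 3) = exp (2 / 3 * ln (cos t))"
    using c by (simp add: power_mean_def powr_def)
  show "exp (t * cot t - 1) < power_mean r (cos t) 1 (2 / 3) \<longleftrightarrow> 0 < gap r (2 / 3) t"
    using e by (cases "r = 0"; cases "0 < r")
      (auto simp: m z g g0 h_def[symmetric] zero_less_divide_iff divide_simps mult.commute)
  show "power_mean r (cos t) 1 (2 / 3) < exp (t * cot t - 1) \<longleftrightarrow> gap r (2 / 3) t < 0"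
    using e by (cases "r = 0"; cases "0 < r")
      (auto simp: m z g g0 h_def[symmetric] divide_less_0_iff divide_simps mult.commute)
qed

section \<open>The four equivalences\<close>

lemma two_sided_bound_ge_6_5:
  assumes "6 / 5 \<le> p"
  shows "two_sided_bound p \<alpha> \<beta> \<longleftrightarrow> 1 - exp (- p) \<le> \<alpha> \<and> \<beta> \<le> 2 / 3"
proof -
  have p: "0 < p" using assms by simp
  have "gap p \<alpha> t < 0" if "1 - exp (- p) \<le> \<alpha>" "t \<in> {0<..<pi / 2}" for t
    using gap_end_neg[OF assms, of t] gap_antimono[of t _ _ p, OF _ _ that(1)] that(2) by fastforce
  moreover have "0 < gap p \<beta> t" if "\<beta> \<le> 2 / 3" "t \<in> {0<..<pi / 2}" for t
    using gap_two_thirds_pos[OF assms, of t] gap_antimono[of t _ _ p, OF _ _ that(1)] that(2) by fastforce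
  ultimately show ?thesis
    unfolding two_sided_bound_iff_pos[OF p]
    using gap_all_neg_imp_ge_end[OF p, of \<alpha>] gap_all_pos_imp_le[of p \<beta>] by blast
qed

lemma two_sided_bound_le_1:
  assumes p: "0 < p" "p \<le> 1"
  shows "two_sided_bound p \<alpha> \<beta> \<longleftrightarrow> 2 / 3 \<le> \<alpha> \<and> \<beta> \<le> 1 - exp (- p)"
proof -
  have p3: "p \<le> ln 3" using p one_le_ln_3 by simp
  have "gap p \<alpha> t < 0" if "2 / 3 \<le> \<alpha>" "t \<in> {0<..<pi / 2}" for t
    using gap_two_thirds_neg[OF p3, of t] gap_antimono[of t _ _ p, OF _ _ that(1)] that(2) by fastforce
  moreover have "0 < gap p \<beta> t" if "\<beta> \<le> 1 - exp (- p)" "t \<in> {0<..<pi / 2}" for t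
    using gap_end_pos[OF p, of t] gap_antimono[of t _ _ p, OF _ _ that(1)] that(2) by fastforce
  ultimately show ?thesis
    unfolding two_sided_bound_iff_pos[OF p(1)]
    using gap_all_neg_imp_ge[of p \<alpha>] gap_all_pos_imp_le_end[OF p(1), of \<beta>] by blast
qed

lemma two_sided_bound_neg:
  assumes p: "p < 0"
  shows "two_sided_bound p \<alpha> \<beta> \<longleftrightarrow> \<alpha> \<le> 0 \<and> 2 / 3 \<le> \<beta>"
proof -
  have p3: "p \<le> ln 3" using p one_le_ln_3 by simp
  have "0 < gap p \<alpha> t" if "\<alpha> \<le> 0" "t \<in> {0<..<pi / 2}" for t
    using gap_zero_pos[OF p, of t] gap_antimono[of t _ _ p, OF _ _ that(1)] that(2) by fastforce
  moreover have "gap p \<beta> t < 0" if "2 / 3 \<le> \<beta>" "t \<in> {0<..<pi / 2}" for t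
    using gap_two_thirds_neg[OF p3, of t] gap_antimono[of t _ _ p, OF _ _ that(1)] that(2) by fastforce
  ultimately show ?thesis
    unfolding two_sided_bound_iff_neg[OF p]
    using gap_all_pos_imp_nonpos[OF p, of \<alpha>] gap_all_neg_imp_ge[of p \<beta>] by blast
qed

lemma gap_two_thirds_all_neg_iff:
  "(\<forall>t\<in>{0<..<pi / 2}. gap p (2 / 3) t < 0) \<longleftrightarrow> p \<le> ln 3"
proof
  assume neg: "\<forall>t\<in>{0<..<pi / 2}. gap p (2 / 3) t < 0"
  show "p \<le> ln 3"
  proof (cases "0 < p")
    case True
    then have "1 - exp (- p) \<le> 2 / 3" using neg by (intro gap_all_neg_imp_ge_end) auto
    then have "exp p \<le> 3" by (simp add: exp_minus field_simps)
    then show ?thesis by (simp add: ln_ge_iff)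
  qed (use one_le_ln_3 in simp)
qed (simp add: gap_two_thirds_neg)

lemma gap_two_thirds_all_pos_iff:
  "(\<forall>t\<in>{0<..<pi / 2}. 0 < gap p (2 / 3) t) \<longleftrightarrow> 6 / 5 \<le> p"
proof
  assume "\<forall>t\<in>{0<..<pi / 2}. 0 < gap p (2 / 3) t"
  then show "6 / 5 \<le> p" using gap_two_thirds_neg_near_0[of p] by fastforce
qed (simp add: gap_two_thirds_pos)

theorem theorem6:
  shows "(\<forall>p \<alpha> \<beta> :: real. p \<ge> 6 / 5 \<longrightarrow>
            (two_sided_bound p \<alpha> \<beta> \<longleftrightarrow> \<alpha> \<ge> 1 - exp (- p) \<and> \<beta> \<le> 2 / 3)) \<and>
         (\<forall>p \<alpha> \<beta> :: real. 0 < p \<and> p \<le> 1 \<longrightarrow>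
            (two_sided_bound p \<alpha> \<beta> \<longleftrightarrow> \<alpha> \<ge> 2 / 3 \<and> \<beta> \<le> 1 - exp (- p))) \<and>
         (\<forall>p \<alpha> \<beta> :: real. p < 0 \<longrightarrow>
            (two_sided_bound p \<alpha> \<beta> \<longleftrightarrow> \<alpha> \<le> 0 \<and> \<beta> \<ge> 2 / 3)) \<and>
         (\<forall>p q :: real.
            (\<forall>t\<in>{0<..<pi / 2}.
               power_mean p (cos t) 1 (2 / 3) < exp (t * cot t - 1) \<and>
               exp (t * cot t - 1) < power_mean q (cos t) 1 (2 / 3)) \<longleftrightarrow>
            p \<le> ln 3 \<and> q \<ge> 6 / 5)"
proof -
  have "(\<forall>t\<in>{0<..<pi / 2}.
      power_mean p (cos t) 1 (2 / 3) < exp (t * cot t - 1) \<and>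
      exp (t * cot t - 1) < power_mean q (cos t) 1 (2 / 3)) \<longleftrightarrow> p \<le> ln 3 \<and> q \<ge> 6 / 5" for p q
    using gap_two_thirds_all_neg_iff[of p] gap_two_thirds_all_pos_iff[of q]
    by (simp add: power_mean_gap ball_conj_distrib)
  then show ?thesis
    using two_sided_bound_ge_6_5 two_sided_bound_le_1 two_sided_bound_neg by blast
qed

end
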